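(* Let $p$ be a prime and let $f \in \mathbb{Z}_p[x]$ be an arbitrary polynomial. Then the sequence $(x_n)_{n \in \mathbb{N}}$ with $x_n = f(n)$ does not have $p$-adic Poissonian pair correlations.
   Context: $\mathbb{N} = \{1,2,3,\ldots\}$. $\mathbb{Z}_p$ is the ring of $p$-adic integers, $|\cdot|_p$ the $p$-adic absolute value normalized by $|p|_p = p^{-1}$, and $\mu$ the Haar measure on $\mathbb{Z}_p$ with $\mu(\mathbb{Z}_p) = 1$. For real $r > 0$ put $D_p(0,r) = \{x \in \mathbb{Z}_p : |x|_p \le r\}$. For a sequence $(x_n)_{n\in\mathbb{N}} \subset \mathbb{Z}_p$, a real number $s > 0$ and $N \in \mathbb{N}$ define $$F_{N,p}(s) := \frac{1}{N^2}\, \frac{1}{\mu\left(D_p(0,s/N)\right)}\, \#\left\{ 1 \le i \ne j \le N : |x_i - x_j|_p \le \frac{s}{N} \right\},$$ where the last factor counts ordered pairs $(i,j)$ of distinct indices. The sequence has $p$-adic Poissonian pair correlations if $\lim_{N\to\infty} F_{N,p}(s) = 1$ for all real $s > 0$. *)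

theory Defs
  imports "HOL-Probability.Probability" "HOL-Algebra.UnivPoly" "HOL-Computational_Algebra.Primes"
begin

section \<open>The ring of $p$-adic integers\<close>

text \<open>
  The ring is the inverse limit of the rings of integers modulo $p^n$: an element \<open>x\<close> is a
  coherent sequence, \<open>x n\<close> being the representative in $\{0,\dots,p^n-1\}$ of its residue
  class modulo $p^n$.
\<close>

definition padic_set :: "nat \<Rightarrow> (nat \<Rightarrow> int) set" where
  "padic_set p = {x. \<forall>n. x n \<in> {0..<int p ^ n} \<and> x (Suc n) mod int p ^ n = x n}"

definition Zp :: "nat \<Rightarrow> (nat \<Rightarrow> int) ring" where
  "Zp p = \<lparr>carrier = padic_set p,
           mult = (\<lambda>x y n. (x n * y n) mod int p ^ n),
           one = (\<lambda>n. 1 mod int p ^ n),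
           zero = (\<lambda>n. 0),
           add = (\<lambda>x y n. (x n + y n) mod int p ^ n)\<rparr>"

text \<open>
  For \<open>x \<noteq> 0\<close> the valuation is the largest \<open>n\<close> such that $p^n$ divides \<open>x\<close>, that is, such
  that the residue \<open>x n\<close> vanishes; see \<open>Zp_residue_zero_iff_dvd\<close> below.
\<close>

definition padic_val :: "(nat \<Rightarrow> int) \<Rightarrow> nat" where
  "padic_val x = (GREATEST n. x n = 0)"

definition padic_abs :: "nat \<Rightarrow> (nat \<Rightarrow> int) \<Rightarrow> real" where
  "padic_abs p x = (if x = \<zero>\<^bsub>Zp p\<^esub> then 0 else 1 / real p ^ padic_val x)"

text \<open>
  The value 0 outside the carrier is a dummy: the locale \<^locale>\<open>Metric_space\<close> requires
  symmetry and nonnegativity on the whole type, but its topology only uses the carrier.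
\<close>

definition padic_dist :: "nat \<Rightarrow> (nat \<Rightarrow> int) \<Rightarrow> (nat \<Rightarrow> int) \<Rightarrow> real" where
  "padic_dist p x y =
     (if x \<in> carrier (Zp p) \<and> y \<in> carrier (Zp p) then padic_abs p (x \<ominus>\<^bsub>Zp p\<^esub> y) else 0)"

definition padic_disc :: "nat \<Rightarrow> real \<Rightarrow> (nat \<Rightarrow> int) set" where
  "padic_disc p r = {x \<in> carrier (Zp p). padic_abs p x \<le> r}"

section \<open>Haar measure\<close>

definition padic_topology :: "nat \<Rightarrow> (nat \<Rightarrow> int) topology" where
  "padic_topology p = Metric_space.mtopology (carrier (Zp p)) (padic_dist p)"

definition padic_borel :: "nat \<Rightarrow> (nat \<Rightarrow> int) measure" where
  "padic_borel p = sigma (carrier (Zp p)) {U. openin (padic_topology p) U}"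

text \<open>
  Regularity is not listed because it is automatic for a finite Borel measure on a compact
  metric space.
\<close>

definition is_padic_haar :: "nat \<Rightarrow> (nat \<Rightarrow> int) measure \<Rightarrow> bool" where
  "is_padic_haar p M \<longleftrightarrow>
     sets M = sets (padic_borel p) \<and>
     emeasure M (carrier (Zp p)) = 1 \<and>
     (\<forall>a\<in>carrier (Zp p). \<forall>A\<in>sets M. emeasure M ((\<lambda>x. a \<oplus>\<^bsub>Zp p\<^esub> x) ` A) = emeasure M A)"

text \<open>Existence and uniqueness are shown in \<open>ex1_padic_haar\<close> below.\<close>

definition padic_haar :: "nat \<Rightarrow> (nat \<Rightarrow> int) measure" where
  "padic_haar p = (THE M. is_padic_haar p M)"

section \<open>Pair correlations\<close>

text \<open>Sequences are indexed by the positive integers; the value \<open>x 0\<close> is never used.\<close>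

definition padic_pair_corr :: "nat \<Rightarrow> (nat \<Rightarrow> nat \<Rightarrow> int) \<Rightarrow> nat \<Rightarrow> real \<Rightarrow> real" where
  "padic_pair_corr p x N s =
     1 / (real N)\<^sup>2 * (1 / measure (padic_haar p) (padic_disc p (s / real N))) *
     real (card {(i, j). i \<in> {1..N} \<and> j \<in> {1..N} \<and> i \<noteq> j \<and>
                         padic_abs p (x i \<ominus>\<^bsub>Zp p\<^esub> x j) \<le> s / real N})"

definition padic_poissonian :: "nat \<Rightarrow> (nat \<Rightarrow> nat \<Rightarrow> int) \<Rightarrow> bool" where
  "padic_poissonian p x \<longleftrightarrow> (\<forall>s>0. (\<lambda>N. padic_pair_corr p x N s) \<longlonglongrightarrow> 1)"

section \<open>Well-definedness\<close>

lemma Zp_simps: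
  "carrier (Zp p) = padic_set p"
  "x \<otimes>\<^bsub>Zp p\<^esub> y = (\<lambda>n. (x n * y n) mod int p ^ n)"
  "\<one>\<^bsub>Zp p\<^esub> = (\<lambda>n. 1 mod int p ^ n)"
  "\<zero>\<^bsub>Zp p\<^esub> = (\<lambda>n. 0)"
  "x \<oplus>\<^bsub>Zp p\<^esub> y = (\<lambda>n. (x n + y n) mod int p ^ n)"
  by (simp_all add: Zp_def)

lemma padic_set_mod: "x \<in> padic_set p \<Longrightarrow> x n mod int p ^ n = x n"
  by (auto simp: padic_set_def)

lemma padic_set_range: "x \<in> padic_set p \<Longrightarrow> 0 \<le> x n \<and> x n < int p ^ n"
  by (auto simp: padic_set_def)

lemma padic_set_coherent:
  assumes "x \<in> padic_set p" "m \<le> n"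
  shows "x n mod int p ^ m = x m"
  using assms(2)
proof (induction n rule: dec_induct)
  case base
  then show ?case using padic_set_mod[OF assms(1)] .
next
  case (step n)
  have "x (Suc n) mod int p ^ m = x (Suc n) mod int p ^ n mod int p ^ m"
    using step by (simp add: mod_mod_cancel le_imp_power_dvd)
  also have "\<dots> = x m" using step assms(1) by (simp add: padic_set_def)
  finally show ?case .
qed

lemma padic_setI:
  assumes "p > 0" "\<And>n. y (Suc n) mod int p ^ n = y n mod int p ^ n"
  shows "(\<lambda>n. y n mod int p ^ n) \<in> padic_set p"
  using assms by (auto simp: padic_set_def mod_mod_cancel le_imp_power_dvd)

lemma padic_setI_binop:
  assumes "p > 0" "x \<in> padic_set p" "y \<in> padic_set p"
    and "\<And>a b c. g (a mod c) (b mod c) mod c = g a b mod (c::int)"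
  shows "(\<lambda>n. g (x n) (y n) mod int p ^ n) \<in> padic_set p"
proof (rule padic_setI[OF assms(1)])
  fix n
  have "x (Suc n) mod int p ^ n = x n mod int p ^ n" "y (Suc n) mod int p ^ n = y n mod int p ^ n"
    using assms(2,3) padic_set_coherent[of _ p n "Suc n"] padic_set_mod by auto
  then show "g (x (Suc n)) (y (Suc n)) mod int p ^ n = g (x n) (y n) mod int p ^ n"
    using assms(4) by metis
qed

lemma padic_of_int: "p > 0 \<Longrightarrow> (\<lambda>n. a mod int p ^ n) \<in> padic_set p"
  by (rule padic_setI) auto

lemma Zp_minus_closed: "p > 0 \<Longrightarrow> x \<in> padic_set p \<Longrightarrow> (\<lambda>n. (- x n) mod int p ^ n) \<in> padic_set p"
  using padic_setI_binop[of p x x "\<lambda>a b. - a"] by (simp add: mod_minus_eq)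

lemma cring_Zp:
  assumes "p > 0"
  shows "cring (Zp p)"
proof (rule cringI)
  show "abelian_group (Zp p)"
  proof (rule abelian_groupI)
    fix x assume x: "x \<in> carrier (Zp p)"
    show "\<exists>y\<in>carrier (Zp p). y \<oplus>\<^bsub>Zp p\<^esub> x = \<zero>\<^bsub>Zp p\<^esub>"
      using Zp_minus_closed[OF assms, of x] x
      by (intro bexI[of _ "\<lambda>n. (- x n) mod int p ^ n"]) (auto simp: Zp_simps mod_simps)
  next
    fix x y assume "x \<in> carrier (Zp p)" "y \<in> carrier (Zp p)"
    then show "x \<oplus>\<^bsub>Zp p\<^esub> y \<in> carrier (Zp p)"
      using padic_setI_binop[OF assms, of x y "(+)"] by (auto simp: Zp_simps mod_simps)
  qed (use padic_of_int[OF assms, of 0] in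
       \<open>auto simp: Zp_simps mod_simps ac_simps fun_eq_iff padic_set_mod\<close>)
  show "Group.comm_monoid (Zp p)"
  proof (rule comm_monoidI)
    fix x y assume "x \<in> carrier (Zp p)" "y \<in> carrier (Zp p)"
    then show "x \<otimes>\<^bsub>Zp p\<^esub> y \<in> carrier (Zp p)"
      using padic_setI_binop[OF assms, of x y "(*)"] by (auto simp: Zp_simps mod_simps)
  qed (use padic_of_int[OF assms, of 1] in
       \<open>auto simp: Zp_simps mod_simps ac_simps fun_eq_iff padic_set_mod\<close>)
qed (auto simp: Zp_simps mod_simps ring_distribs)

lemma Zp_minus:
  assumes "p > 0" "x \<in> padic_set p" "y \<in> padic_set p"
  shows "x \<ominus>\<^bsub>Zp p\<^esub> y = (\<lambda>n. (x n - y n) mod int p ^ n)"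
proof -
  interpret cring "Zp p" by (rule cring_Zp[OF assms(1)])
  have "\<ominus>\<^bsub>Zp p\<^esub> y = (\<lambda>n. (- y n) mod int p ^ n)"
    using assms Zp_minus_closed[of p y]
    by (intro minus_equality) (auto simp: Zp_simps mod_simps)
  then show ?thesis by (simp add: a_minus_def Zp_simps mod_simps)
qed

lemma Zp_residue_zero_mono:
  "x \<in> padic_set p \<Longrightarrow> x n = 0 \<Longrightarrow> m \<le> n \<Longrightarrow> x m = 0"
  using padic_set_coherent[of x p m n] by auto

lemma Zp_residue_zero_iff_dvd:
  assumes "p > 0" "x \<in> carrier (Zp p)"
  shows "x n = 0 \<longleftrightarrow> (\<exists>y\<in>carrier (Zp p). x = (\<lambda>k. int p ^ n mod int p ^ k) \<otimes>\<^bsub>Zp p\<^esub> y)"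
proof
  assume 0: "x n = 0"
  have x: "x \<in> padic_set p" using assms by (simp add: Zp_simps)
  have dvd: "int p ^ n dvd x (n + k)" for k
    using padic_set_coherent[OF x, of n "n + k"] 0 by auto
  define y where "y = (\<lambda>k. x (n + k) div int p ^ n)"
  have eq: "int p ^ n * y k = x (n + k)" for k using dvd[of k] by (simp add: y_def)
  have y: "y \<in> padic_set p"
    unfolding padic_set_def
  proof (intro CollectI allI conjI)
    fix k
    have "0 \<le> int p ^ n * y k" "int p ^ n * y k < int p ^ n * int p ^ k"
      using padic_set_range[OF x, of "n + k"] eq by (auto simp: power_add)
    then show "y k \<in> {0..<int p ^ k}"
      using assms(1) by (auto simp: zero_le_mult_iff power_le_zero_eq)
    have "int p ^ n * (y (Suc k) mod int p ^ k) = x (n + Suc k) mod int p ^ (n + k)"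
      by (simp only: eq[symmetric] power_add mult_mod_right)
    also have "\<dots> = int p ^ n * y k"
      using padic_set_coherent[OF x, of "n + k" "n + Suc k"] by (simp add: eq)
    finally show "y (Suc k) mod int p ^ k = y k" using assms(1) by simp
  qed
  have "x k = (int p ^ n mod int p ^ k * y k) mod int p ^ k" for k
    using padic_set_coherent[OF x, of k "n + k"] by (simp add: mod_simps eq)
  then show "\<exists>y\<in>carrier (Zp p). x = (\<lambda>k. int p ^ n mod int p ^ k) \<otimes>\<^bsub>Zp p\<^esub> y"
    using y by (auto simp: Zp_simps)
qed (auto simp: Zp_simps)

lemma padic_val_eq:
  assumes "x \<in> padic_set p" "x \<noteq> (\<lambda>n. 0)"
  shows "x n = 0 \<longleftrightarrow> n \<le> padic_val x"
proof -
  obtain m where m: "x m \<noteq> 0" using assms(2) by auto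
  have 0: "x 0 = 0" using padic_set_range[OF assms(1), of 0] by simp
  have bd: "k \<le> m" if "x k = 0" for k
    using Zp_residue_zero_mono[OF assms(1) that] m by (metis nle_le)
  have "x (padic_val x) = 0" unfolding padic_val_def
    by (rule GreatestI_nat[where P = "\<lambda>n. x n = 0", OF 0 bd])
  moreover have "n \<le> padic_val x" if "x n = 0" unfolding padic_val_def
    by (rule Greatest_le_nat[where P = "\<lambda>n. x n = 0", OF that bd])
  ultimately show ?thesis using Zp_residue_zero_mono[OF assms(1)] by blast
qed

lemma padic_abs_le_iff:
  assumes "p > 1" "x \<in> padic_set p"
  shows "padic_abs p x \<le> 1 / real p ^ n \<longleftrightarrow> x n = 0"
proof (cases "x = (\<lambda>n. 0)")
  case False
  then show ?thesis
    using padic_val_eq[OF assms(2) False, of n] assms(1)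
    by (simp add: padic_abs_def Zp_simps field_simps power_increasing_iff)
qed (simp add: padic_abs_def Zp_simps)

lemma padic_abs_nonneg: "padic_abs p x \<ge> 0"
  by (simp add: padic_abs_def)

lemma padic_dist_le_iff:
  assumes "p > 1" "x \<in> padic_set p" "y \<in> padic_set p"
  shows "padic_dist p x y \<le> 1 / real p ^ n \<longleftrightarrow> x n = y n"
proof -
  interpret cring "Zp p" using assms(1) by (intro cring_Zp) auto
  have "padic_dist p x y \<le> 1 / real p ^ n \<longleftrightarrow> (x n - y n) mod int p ^ n = 0"
    using padic_abs_le_iff[OF assms(1), of "x \<ominus>\<^bsub>Zp p\<^esub> y" n] minus_closed[of x y] assms
    by (simp add: Zp_minus padic_dist_def) (simp add: Zp_simps)
  also have "\<dots> \<longleftrightarrow> x n = y n"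
    using padic_set_mod[OF assms(2), of n] padic_set_mod[OF assms(3), of n]
    by (metis mod_0_imp_dvd mod_eq_dvd_iff dvd_imp_mod_0)
  finally show ?thesis .
qed

lemma padic_dist_leI:
  assumes p: "p > 1" and mem: "x \<in> padic_set p" "y \<in> padic_set p" "u \<in> padic_set p" "v \<in> padic_set p"
    and imp: "\<And>n. u n = v n \<Longrightarrow> x n = y n"
  shows "padic_dist p x y \<le> padic_dist p u v"
proof -
  interpret cring "Zp p" using p by (intro cring_Zp) auto
  show ?thesis
  proof (cases "padic_dist p u v = 0")
    case True
    have "u n = v n" for n
      using padic_dist_le_iff[OF p mem(3,4), of n] True by simp
    then have "x = y" using imp by auto
    then show ?thesis using mem True p by (simp add: padic_dist_def Zp_minus padic_abs_def Zp_simps)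
  next
    case False
    then obtain k where k: "padic_dist p u v = 1 / real p ^ k"
      by (auto simp: padic_dist_def padic_abs_def split: if_splits)
    then have "u k = v k" using padic_dist_le_iff[OF p mem(3,4), of k] by simp
    then show ?thesis using imp padic_dist_le_iff[OF p mem(1,2), of k] k by simp
  qed
qed

lemma Metric_space_padic:
  assumes p: "p > 1"
  shows "Metric_space (carrier (Zp p)) (padic_dist p)"
proof
  fix x y show "0 \<le> padic_dist p x y"
    by (simp add: padic_dist_def padic_abs_nonneg)
  show "padic_dist p x y = padic_dist p y x"
  proof (cases "x \<in> padic_set p \<and> y \<in> padic_set p")
    case True
    then show ?thesis by (intro antisym padic_dist_leI[OF p]) auto
  qed (auto simp: padic_dist_def Zp_simps)
next
  fix x y assume "x \<in> carrier (Zp p)" "y \<in> carrier (Zp p)"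
  then have mem: "x \<in> padic_set p" "y \<in> padic_set p" by (simp_all add: Zp_simps)
  show "padic_dist p x y = 0 \<longleftrightarrow> x = y"
  proof
    assume 0: "padic_dist p x y = 0"
    have "x n = y n" for n
      using padic_dist_le_iff[OF p mem, of n] 0 by simp
    then show "x = y" by auto
  qed (use mem p in \<open>simp add: padic_dist_def Zp_minus padic_abs_def Zp_simps\<close>)
next
  fix x y z assume "x \<in> carrier (Zp p)" "y \<in> carrier (Zp p)" "z \<in> carrier (Zp p)"
  then have mem: "x \<in> padic_set p" "y \<in> padic_set p" "z \<in> padic_set p" by (simp_all add: Zp_simps)
  have nn: "padic_dist p x y \<ge> 0" "padic_dist p y z \<ge> 0"
    by (simp_all add: padic_dist_def padic_abs_nonneg)
  have aux: "u n = v n" if "padic_dist p u v \<le> padic_dist p u' v'" "u' n = v' n"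
    "u \<in> padic_set p" "v \<in> padic_set p" "u' \<in> padic_set p" "v' \<in> padic_set p" for u v u' v' n
    using that padic_dist_le_iff[OF p, of u v n] padic_dist_le_iff[OF p, of u' v' n] by simp
  show "padic_dist p x z \<le> padic_dist p x y + padic_dist p y z"
  proof (cases "padic_dist p x y \<le> padic_dist p y z")
    case True
    have "padic_dist p x z \<le> padic_dist p y z"
      using aux[OF True] mem by (intro padic_dist_leI[OF p]) auto
    then show ?thesis using nn by simp
  next
    case False
    then have le: "padic_dist p y z \<le> padic_dist p x y" by simp
    have "padic_dist p x z \<le> padic_dist p x y"
      using aux[OF le] mem by (intro padic_dist_leI[OF p]) auto
    then show ?thesis using nn by simp
  qed
qed

definition padic_class :: "nat \<Rightarrow> nat \<Rightarrow> int \<Rightarrow> (nat \<Rightarrow> int) set" where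
  "padic_class p n a = {x \<in> carrier (Zp p). x n = a}"

lemma padic_class_0: "padic_class p 0 0 = carrier (Zp p)"
proof -
  have "x 0 = 0" if "x \<in> padic_set p" for x
    using padic_set_range[OF that, of 0] by simp
  then show ?thesis by (auto simp: padic_class_def Zp_simps)
qed

lemma padic_disc_eq_class:
  "p > 1 \<Longrightarrow> padic_disc p (1 / real p ^ n) = padic_class p n 0"
  by (auto simp: padic_disc_def padic_class_def padic_abs_le_iff Zp_simps)

lemma openin_padic:
  assumes p: "p > 1"
  shows "openin (padic_topology p) U \<longleftrightarrow>
    U \<subseteq> carrier (Zp p) \<and> (\<forall>x\<in>U. \<exists>n. padic_class p n (x n) \<subseteq> U)"
proof -
  interpret Metric_space "carrier (Zp p)" "padic_dist p" by (rule Metric_space_padic[OF p])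
  have eq: "(\<exists>r>0. mball x r \<subseteq> U) \<longleftrightarrow> (\<exists>n. padic_class p n (x n) \<subseteq> U)" if x: "x \<in> padic_set p" for x
  proof safe
    fix r :: real assume r: "r > 0" "mball x r \<subseteq> U"
    obtain n where n: "1 / real p ^ n < r"
      using real_arch_pow_inv[OF r(1), of "1 / real p"] p by (auto simp: power_divide)
    have "padic_class p n (x n) \<subseteq> mball x r"
    proof
      fix y assume "y \<in> padic_class p n (x n)"
      then have y: "y \<in> padic_set p" "x n = y n" by (auto simp: padic_class_def Zp_simps)
      then show "y \<in> mball x r"
        using padic_dist_le_iff[OF p x y(1), of n] n x 
        unfolding in_mball by (simp add: Zp_simps)
    qed
    then show "\<exists>n. padic_class p n (x n) \<subseteq> U" using r by blast
  next
    fix n assume n: "padic_class p n (x n) \<subseteq> U"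
    have "mball x (1 / real p ^ n) \<subseteq> padic_class p n (x n)"
    proof
      fix y assume "y \<in> mball x (1 / real p ^ n)"
      then show "y \<in> padic_class p n (x n)"
        using padic_dist_le_iff[OF p x, of y n] 
        unfolding in_mball by (simp add: Zp_simps padic_class_def)
    qed
    then show "\<exists>r>0. mball x r \<subseteq> U" using n p by (intro exI[of _ "1 / real p ^ n"]) auto
  qed
  show ?thesis
    unfolding padic_topology_def openin_mtopology Ball_def
    using eq unfolding Zp_simps by (meson subsetD)
qed

lemma openin_padic_class: "p > 1 \<Longrightarrow> openin (padic_topology p) (padic_class p n a)"
  by (auto simp: openin_padic padic_class_def)

lemma space_padic_borel: "p > 1 \<Longrightarrow> space (padic_borel p) = carrier (Zp p)"
  by (auto simp: padic_borel_def space_measure_of_conv)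

lemma sets_padic_borel:
  assumes p: "p > 1"
  shows "sets (padic_borel p) =
    sigma_sets (carrier (Zp p)) (insert {} (range (\<lambda>(n, a). padic_class p n a)))"
    (is "_ = sigma_sets ?\<Omega> ?E")
proof -
  have sub: "{U. openin (padic_topology p) U} \<subseteq> Pow ?\<Omega>"
    by (auto simp: openin_padic[OF p])
  have E: "?E \<subseteq> Pow ?\<Omega>" by (auto simp: padic_class_def)
  have "sigma_sets ?\<Omega> {U. openin (padic_topology p) U} = sigma_sets ?\<Omega> ?E"
  proof (rule sigma_sets_eqI)
    fix U assume U: "U \<in> {U. openin (padic_topology p) U}"
    define I where "I = {(n, a). padic_class p n a \<subseteq> U}"
    have "U = (\<Union>(n, a)\<in>I. padic_class p n a)"
    proof safe
      fix x assume "x \<in> U"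
      then show "x \<in> (\<Union>(n, a)\<in>I. padic_class p n a)"
        using U by (fastforce simp: openin_padic[OF p] I_def padic_class_def)
    qed (auto simp: I_def)
    moreover have "(\<Union>(n, a)\<in>I. padic_class p n a) \<in> sigma_sets ?\<Omega> ?E"
    proof -
      interpret sigma_algebra ?\<Omega> "sigma_sets ?\<Omega> ?E" by (rule sigma_algebra_sigma_sets[OF E])
      show ?thesis by (intro countable_UN'') auto
    qed
    ultimately show "U \<in> sigma_sets ?\<Omega> ?E" by simp
  next
    fix U assume "U \<in> ?E"
    then show "U \<in> sigma_sets ?\<Omega> {U. openin (padic_topology p) U}"
      using openin_padic_class[OF p] by (auto intro: sigma_sets.Basic sigma_sets.Empty)
  qed
  then show ?thesis by (simp add: padic_borel_def sub)
qed

lemma padic_class_in_borel: "p > 1 \<Longrightarrow> padic_class p n a \<in> sets (padic_borel p)"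
  by (subst sets_padic_borel) (auto intro: sigma_sets.Basic)

lemma padic_measure_eqI:
  assumes p: "p > 1"
    and sets: "sets M = sets (padic_borel p)" "sets N = sets (padic_borel p)"
    and M: "\<And>n a. 0 \<le> a \<Longrightarrow> a < int p ^ n \<Longrightarrow> emeasure M (padic_class p n a) = ennreal (1 / real p ^ n)"
    and N: "\<And>n a. 0 \<le> a \<Longrightarrow> a < int p ^ n \<Longrightarrow> emeasure N (padic_class p n a) = ennreal (1 / real p ^ n)"
  shows "M = N"
proof (rule measure_eqI_generator_eq)
  let ?E = "insert {} (range (\<lambda>(n, a). padic_class p n a))"
  have inter: "padic_class p n a \<inter> padic_class p m b \<in> ?E" if "n \<le> m" for n m a b
  proof (cases "b mod int p ^ n = a")
    case True
    then have "padic_class p n a \<inter> padic_class p m b = padic_class p m b"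
      using padic_set_coherent[OF _ that] by (auto simp: padic_class_def Zp_simps)
    then show ?thesis by (auto intro!: image_eqI[of _ _ "(m, b)"])
  next
    case False
    then have "padic_class p n a \<inter> padic_class p m b = {}"
      using padic_set_coherent[OF _ that] by (auto simp: padic_class_def Zp_simps)
    then show ?thesis by simp
  qed
  then have "padic_class p n a \<inter> padic_class p m b \<in> ?E" for n m a b
    using inter[of n m a b] inter[of m n b a] by (metis Int_commute nle_le)
  then show "Int_stable ?E"
    by (auto simp: Int_stable_def simp del: insert_iff)
  show "?E \<subseteq> Pow (carrier (Zp p))" by (auto simp: padic_class_def)
  show "sets M = sigma_sets (carrier (Zp p)) ?E" "sets N = sigma_sets (carrier (Zp p)) ?E"
    using sets sets_padic_borel[OF p] by auto
  note C = padic_class_0[of p]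
  show "range (\<lambda>_. padic_class p 0 0) \<subseteq> ?E" by auto
  show "(\<Union>i::nat. padic_class p 0 0) = carrier (Zp p)" by (simp add: C)
  show "emeasure M (padic_class p 0 0) \<noteq> \<infinity>" using M[of 0 0] by simp
  fix X assume "X \<in> ?E"
  then consider "X = {}" | n a where "X = padic_class p n a" by auto
  then show "emeasure M X = emeasure N X"
  proof cases
    case 2
    show ?thesis
    proof (cases "0 \<le> a \<and> a < int p ^ n")
      case False
      then have "X = {}" using 2 padic_set_range[of _ p n] by (auto simp: padic_class_def Zp_simps)
      then show ?thesis by simp
    qed (use M N 2 in auto)
  qed auto
qed

lemma padic_translate_class:
  assumes p: "p > 1" and c: "c \<in> carrier (Zp p)"
  shows "(\<lambda>x. c \<oplus>\<^bsub>Zp p\<^esub> x) -` padic_class p n a \<inter> carrier (Zp p) =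
    (if 0 \<le> a \<and> a < int p ^ n then padic_class p n ((a - c n) mod int p ^ n) else {})"
proof -
  interpret cring "Zp p" using p by (intro cring_Zp) auto
  have "(c n + x n) mod int p ^ n = a \<longleftrightarrow>
      0 \<le> a \<and> a < int p ^ n \<and> x n = (a - c n) mod int p ^ n" if x: "x \<in> padic_set p" for x
  proof -
    have pos: "int p ^ n > 0" using p by simp
    have "x n = (a - c n) mod int p ^ n" if "(c n + x n) mod int p ^ n = a"
    proof -
      have "(a - c n) mod int p ^ n = x n mod int p ^ n"
        unfolding that[symmetric] by (simp add: mod_simps)
      then show ?thesis using padic_set_mod[OF x] by simp
    qed
    moreover have "(c n + x n) mod int p ^ n = a"
      if "x n = (a - c n) mod int p ^ n" "0 \<le> a" "a < int p ^ n"
      using that by (simp add: mod_simps)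
    moreover have "0 \<le> (c n + x n) mod int p ^ n" "(c n + x n) mod int p ^ n < int p ^ n"
      using pos by (rule pos_mod_sign, rule pos_mod_bound)
    ultimately show ?thesis by metis
  qed
  moreover have "x \<in> padic_set p \<Longrightarrow> c \<oplus>\<^bsub>Zp p\<^esub> x \<in> padic_set p" for x
    using a_closed[OF c, of x] by (simp only: Zp_simps(1))
  ultimately show ?thesis
    unfolding padic_class_def Zp_simps by auto
qed

lemma padic_translate_measurable:
  assumes p: "p > 1" and c: "c \<in> carrier (Zp p)" and M: "sets M = sets (padic_borel p)"
  shows "(\<lambda>x. c \<oplus>\<^bsub>Zp p\<^esub> x) \<in> measurable M (padic_borel p)"
proof -
  interpret cring "Zp p" using p by (intro cring_Zp) auto
  have sp: "space M = carrier (Zp p)" using sets_eq_imp_space_eq[OF M] space_padic_borel[OF p] by simp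
  show ?thesis
  proof (rule measurable_sigma_sets[OF sets_padic_borel[OF p]])
    fix A assume "A \<in> insert {} (range (\<lambda>(n, a). padic_class p n a))"
    then show "(\<lambda>x. c \<oplus>\<^bsub>Zp p\<^esub> x) -` A \<inter> space M \<in> sets M"
      using padic_class_in_borel[OF p] by (auto simp: sp M padic_translate_class[OF p c])
  qed (use c sp in \<open>auto simp: padic_class_def\<close>)
qed

lemma padic_translate_image:
  assumes p: "p > 1" and c: "c \<in> carrier (Zp p)" and A: "A \<subseteq> carrier (Zp p)"
  shows "(\<lambda>x. c \<oplus>\<^bsub>Zp p\<^esub> x) ` A = (\<lambda>x. (\<ominus>\<^bsub>Zp p\<^esub> c) \<oplus>\<^bsub>Zp p\<^esub> x) -` A \<inter> carrier (Zp p)"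
proof -
  interpret cring "Zp p" using p by (intro cring_Zp) auto
  show ?thesis
  proof (intro equalityI subsetI)
    fix y assume "y \<in> (\<lambda>x. c \<oplus>\<^bsub>Zp p\<^esub> x) ` A"
    then obtain x where x: "x \<in> A" "y = c \<oplus>\<^bsub>Zp p\<^esub> x" by blast
    then have "x \<in> carrier (Zp p)" using A by blast
    then show "y \<in> (\<lambda>x. (\<ominus>\<^bsub>Zp p\<^esub> c) \<oplus>\<^bsub>Zp p\<^esub> x) -` A \<inter> carrier (Zp p)"
      using x c r_neg1[of c x] by simp
  next
    fix y assume y: "y \<in> (\<lambda>x. (\<ominus>\<^bsub>Zp p\<^esub> c) \<oplus>\<^bsub>Zp p\<^esub> x) -` A \<inter> carrier (Zp p)"
    then have "y = c \<oplus>\<^bsub>Zp p\<^esub> ((\<ominus>\<^bsub>Zp p\<^esub> c) \<oplus>\<^bsub>Zp p\<^esub> y)" using c r_neg2[of c y] by simp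
    then show "y \<in> (\<lambda>x. c \<oplus>\<^bsub>Zp p\<^esub> x) ` A" using y by blast
  qed
qed

lemma is_padic_haar_class:
  assumes p: "p > 1" and M: "is_padic_haar p M" and a: "0 \<le> a" "a < int p ^ n"
  shows "emeasure M (padic_class p n a) = ennreal (1 / real p ^ n)"
proof -
  interpret cring "Zp p" using p by (intro cring_Zp) auto
  have sets: "sets M = sets (padic_borel p)" using M by (simp add: is_padic_haar_def)
  have eq: "emeasure M (padic_class p n b) = emeasure M (padic_class p n 0)"
    if b: "0 \<le> b" "b < int p ^ n" for b
  proof -
    define c where "c = (\<lambda>k. (- b) mod int p ^ k)"
    have c: "c \<in> carrier (Zp p)" unfolding c_def Zp_simps using padic_of_int[of p "-b"] p by simp
    have "(\<lambda>x. (\<ominus>\<^bsub>Zp p\<^esub> c) \<oplus>\<^bsub>Zp p\<^esub> x) ` padic_class p n 0 = padic_class p n b"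
      using padic_translate_image[OF p, of "\<ominus>\<^bsub>Zp p\<^esub> c" "padic_class p n 0"] c
        padic_translate_class[OF p c, of n 0] b p
      by (auto simp: padic_class_def c_def mod_simps)
    then show ?thesis
      using M c padic_class_in_borel[OF p, of n 0] sets a_inv_closed[OF c]
      unfolding is_padic_haar_def by metis
  qed
  have "carrier (Zp p) = (\<Union>b\<in>{0..<int p ^ n}. padic_class p n b)"
    using padic_set_range by (auto simp: padic_class_def Zp_simps)
  then have "1 = emeasure M (\<Union>b\<in>{0..<int p ^ n}. padic_class p n b)"
    using M by (simp add: is_padic_haar_def)
  also have "\<dots> = (\<Sum>b\<in>{0..<int p ^ n}. emeasure M (padic_class p n b))"
    by (rule sum_emeasure[symmetric])
       (use padic_class_in_borel[OF p] in \<open>auto simp: sets disjoint_family_on_def padic_class_def\<close>)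
  also have "\<dots> = of_nat (p ^ n) * emeasure M (padic_class p n 0)"
    using eq by (simp add: nat_power_eq)
  finally have 1: "1 = of_nat (p ^ n) * emeasure M (padic_class p n 0)" .
  have "emeasure M (padic_class p n 0) \<noteq> \<top>"
    using 1 p by (auto simp: ennreal_mult_top)
  then obtain r where r: "emeasure M (padic_class p n 0) = ennreal r" "r \<ge> 0"
    by (cases "emeasure M (padic_class p n 0)") auto
  have "ennreal 1 = ennreal (real (p ^ n) * r)"
    using 1 r by (simp add: ennreal_mult ennreal_of_nat_eq_real_of_nat)
  then have "1 = real (p ^ n) * r" using r by (subst (asm) ennreal_inj) auto
  then have "r = 1 / real p ^ n" using p by (simp add: field_simps)
  then show ?thesis using eq[OF a] r by simp
qed

definition padic_of_digits :: "nat \<Rightarrow> (nat \<Rightarrow> int) \<Rightarrow> nat \<Rightarrow> int" where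
  "padic_of_digits p d n = (\<Sum>i<n. d i * int p ^ i)"

lemma padic_of_digits_range:
  assumes "p > 1" "\<And>i. d i \<in> {0..<int p}"
  shows "padic_of_digits p d n \<in> {0..<int p ^ n}"
proof (induction n)
  case (Suc n)
  have "d n * int p ^ n \<le> (int p - 1) * int p ^ n"
    using assms(2)[of n] by (intro mult_right_mono) auto
  moreover have "0 \<le> d n * int p ^ n" using assms(2)[of n] by simp
  ultimately show ?case using Suc by (auto simp: padic_of_digits_def algebra_simps)
qed (simp add: padic_of_digits_def)

lemma padic_of_digits_mem:
  assumes "p > 1" "\<And>i. d i \<in> {0..<int p}"
  shows "padic_of_digits p d \<in> padic_set p"
proof -
  have r: "padic_of_digits p d n \<in> {0..<int p ^ n}" for n
    by (rule padic_of_digits_range[OF assms])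
  have "padic_of_digits p d (Suc n) mod int p ^ n = padic_of_digits p d n mod int p ^ n" for n
    by (simp add: padic_of_digits_def)
  moreover have "padic_of_digits p d n mod int p ^ n = padic_of_digits p d n" for n
    using r[of n] by simp
  ultimately show ?thesis using r by (simp add: padic_set_def)
qed

lemma padic_of_digits_eq_iff:
  assumes p: "p > 1" and d: "\<And>i. d i \<in> {0..<int p}" and a: "0 \<le> a" "a < int p ^ n"
  shows "padic_of_digits p d n = a \<longleftrightarrow> (\<forall>i<n. d i = a div int p ^ i mod int p)"
  using a
proof (induction n arbitrary: a)
  case 0
  then show ?case by (simp add: padic_of_digits_def)
next
  case (Suc n)
  have pos: "int p ^ n > 0" using p by simp
  let ?s = "padic_of_digits p d n"
  have s: "?s \<in> {0..<int p ^ n}" by (rule padic_of_digits_range[OF p d])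
  have top: "a div int p ^ n mod int p = a div int p ^ n"
  proof (rule mod_pos_pos_trivial)
    show "0 \<le> a div int p ^ n" using Suc.prems pos by (simp add: pos_imp_zdiv_nonneg_iff)
    show "a div int p ^ n < int p"
    proof (rule ccontr)
      assume "\<not> a div int p ^ n < int p"
      then have "int p * int p ^ n \<le> a div int p ^ n * int p ^ n"
        using pos by (intro mult_right_mono) auto
      also have "\<dots> \<le> a"
        using pos_mod_sign[OF pos, of a] div_mult_mod_eq[of a "int p ^ n"] by linarith
      finally show False using Suc.prems by simp
    qed
  qed
  have low: "a mod int p ^ n div int p ^ i mod int p = a div int p ^ i mod int p" if "i < n" for i
  proof -
    have "a = a mod int p ^ n + int p ^ i * (int p * (int p ^ (n - Suc i) * (a div int p ^ n)))"
    proof -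
      have "int p ^ n = int p ^ i * (int p * int p ^ (n - Suc i))"
        using that by (simp flip: power_Suc power_add)
      then show ?thesis by (metis mod_mult_div_eq mult.assoc)
    qed
    then have "a div int p ^ i = a mod int p ^ n div int p ^ i + int p * (int p ^ (n - Suc i) * (a div int p ^ n))"
      using p by (metis div_mult_self2 add.commute of_nat_eq_0_iff power_eq_0_iff not_less0)
    then show ?thesis by simp
  qed
  have "padic_of_digits p d (Suc n) = a \<longleftrightarrow> ?s + d n * int p ^ n = a"
    by (simp add: padic_of_digits_def)
  also have "\<dots> \<longleftrightarrow> ?s = a mod int p ^ n \<and> d n = a div int p ^ n"
    using s pos div_mult_mod_eq[of a "int p ^ n"] by (auto simp: add.commute)
  also have "?s = a mod int p ^ n \<longleftrightarrow> (\<forall>i<n. d i = a div int p ^ i mod int p)"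
    using Suc.IH[of "a mod int p ^ n"] pos low by simp
  finally show ?case using top by (auto simp: less_Suc_eq)
qed

lemma is_padic_haar_exists:
  assumes p: "p > 1"
  shows "\<exists>M. is_padic_haar p M"
proof -
  define D where "D = (\<lambda>i::nat. uniform_count_measure {0..<int p})"
  define P where "P = PiM UNIV D"
  define M where "M = distr P (padic_borel p) (padic_of_digits p)"
  have D: "prob_space (D i)" for i
    unfolding D_def using p by (intro prob_space_uniform_count_measure) auto
  have spD: "space (D i) = {0..<int p}" "sets (D i) = Pow {0..<int p}" for i
    by (auto simp: D_def space_uniform_count_measure sets_uniform_count_measure)
  have spP: "d \<in> space P \<longleftrightarrow> (\<forall>i. d i \<in> {0..<int p})" for d
    by (auto simp: P_def space_PiM spD PiE_def)
  define cyl where "cyl = (\<lambda>n a. prod_emb UNIV D {..<n} (\<Pi>\<^sub>E i\<in>{..<n}. {a div int p ^ i mod int p}))"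
  have cyl_eq: "padic_of_digits p -` padic_class p n a \<inter> space P = cyl n a"
    if "0 \<le> a" "a < int p ^ n" for n a
  proof (rule Set.set_eqI)
    fix d
    show "d \<in> padic_of_digits p -` padic_class p n a \<inter> space P \<longleftrightarrow> d \<in> cyl n a"
    proof (cases "d \<in> space P")
      case True
      then have dd: "\<And>i. d i \<in> {0..<int p}" by (simp add: spP)
      show ?thesis
        using padic_of_digits_eq_iff[OF p dd that] padic_of_digits_mem[OF p dd] True dd
        by (auto simp: cyl_def prod_emb_def padic_class_def Zp_simps spD PiE_iff)
    next
      case False
      then show ?thesis by (auto simp: cyl_def prod_emb_def spP spD PiE_iff)
    qed
  qed
  have dig: "{a div int p ^ i mod int p} \<in> sets (D i)" for a i
    using p by (simp add: spD)
  have cyl_sets: "cyl n a \<in> sets P" for n a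
    unfolding cyl_def P_def by (rule sets_PiM_I) (use dig in auto)
  have cyl_meas: "emeasure P (cyl n a) = ennreal (1 / real p ^ n)" for n a
  proof -
    have "emeasure P (cyl n a) = (\<Prod>i<n. emeasure (D i) {a div int p ^ i mod int p})"
      unfolding cyl_def P_def by (rule emeasure_PiM_emb) (use dig D in auto)
    also have "\<dots> = (\<Prod>i<n. ennreal (1 / real p))"
      using p by (intro prod.cong refl) (simp add: D_def emeasure_uniform_count_measure)
    also have "\<dots> = ennreal (1 / real p ^ n)"
      by (simp add: ennreal_power power_divide)
    finally show ?thesis .
  qed
  have meas: "padic_of_digits p \<in> measurable P (padic_borel p)"
  proof (rule measurable_sigma_sets[OF sets_padic_borel[OF p]])
    fix A assume "A \<in> insert {} (range (\<lambda>(n, a). padic_class p n a))"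
    then consider "A = {}" | n a where "A = padic_class p n a" by auto
    then show "padic_of_digits p -` A \<inter> space P \<in> sets P"
    proof cases
      case 2
      show ?thesis
      proof (cases "0 \<le> a \<and> a < int p ^ n")
        case True
        then show ?thesis using 2 cyl_eq cyl_sets by simp
      next
        case False
        then have "A = {}" using 2 padic_set_range[of _ p n] by (auto simp: padic_class_def Zp_simps)
        then show ?thesis by simp
      qed
    qed simp
  qed (use padic_of_digits_mem[OF p] in \<open>auto simp: padic_class_def Zp_simps spP\<close>)
  have sets: "sets M = sets (padic_borel p)" by (simp add: M_def)
  have sp: "space M = carrier (Zp p)" by (simp add: M_def space_padic_borel[OF p])
  have cls: "emeasure M (padic_class p n a) = ennreal (1 / real p ^ n)" if "0 \<le> a" "a < int p ^ n" for n a
    unfolding M_def using meas padic_class_in_borel[OF p] cyl_eq[OF that] cyl_meas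
    by (simp add: emeasure_distr)
  note C = padic_class_0[of p]
  have "is_padic_haar p M"
    unfolding is_padic_haar_def
  proof (intro conjI ballI)
    show "emeasure M (carrier (Zp p)) = 1" using cls[of 0 0] C by simp
  next
    fix c A assume c: "c \<in> carrier (Zp p)" and A: "A \<in> sets M"
    interpret cring "Zp p" using p by (intro cring_Zp) auto
    have c': "\<ominus>\<^bsub>Zp p\<^esub> c \<in> carrier (Zp p)" using c by simp
    let ?t = "\<lambda>x. (\<ominus>\<^bsub>Zp p\<^esub> c) \<oplus>\<^bsub>Zp p\<^esub> x"
    have t: "?t \<in> measurable M (padic_borel p)"
      by (rule padic_translate_measurable[OF p c' sets])
    have "distr M (padic_borel p) ?t = M"
    proof (rule padic_measure_eqI[OF p])
      fix n a assume a: "0 \<le> (a::int)" "a < int p ^ n"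
      show "emeasure (distr M (padic_borel p) ?t) (padic_class p n a) = ennreal (1 / real p ^ n)"
        using t padic_class_in_borel[OF p] padic_translate_class[OF p c', of n a] a p
        by (simp add: emeasure_distr sp cls)
    qed (use sets cls in auto)
    then have "emeasure M A = emeasure (distr M (padic_borel p) ?t) A" by simp
    also have "\<dots> = emeasure M (?t -` A \<inter> carrier (Zp p))"
      using t A sets by (simp add: emeasure_distr sp)
    also have "?t -` A \<inter> carrier (Zp p) = (\<lambda>x. c \<oplus>\<^bsub>Zp p\<^esub> x) ` A"
      using padic_translate_image[OF p c, of A] sets.sets_into_space[OF A] sp by simp
    finally show "emeasure M ((\<lambda>x. c \<oplus>\<^bsub>Zp p\<^esub> x) ` A) = emeasure M A" by simp
  qed (rule sets)
  then show ?thesis by blast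
qed

lemma ex1_padic_haar:
  assumes p: "p > 1"
  shows "\<exists>!M. is_padic_haar p M"
proof (rule ex_ex1I[OF is_padic_haar_exists[OF p]])
  fix M N assume "is_padic_haar p M" "is_padic_haar p N"
  then show "M = N"
    by (intro padic_measure_eqI[OF p] is_padic_haar_class[OF p]) (auto simp: is_padic_haar_def)
qed

lemma is_padic_haar_padic_haar: "p > 1 \<Longrightarrow> is_padic_haar p (padic_haar p)"
  unfolding padic_haar_def by (rule theI'[OF ex1_padic_haar])

lemma measure_padic_disc:
  assumes p: "p > 1"
  shows "measure (padic_haar p) (padic_disc p (1 / real p ^ n)) = 1 / real p ^ n"
  using is_padic_haar_class[OF p is_padic_haar_padic_haar[OF p], of 0 n] p
  by (simp add: measure_def padic_disc_eq_class)

end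

theory Submission
  imports Defs
begin

text \<open>
  A polynomial respects congruences, so the residues of $f(n)$ modulo $p^k$ are periodic in
  $n$ with period $p^k$ (\<open>Zp_eval_cong\<close>). Every sequence with this periodicity fails to be
  Poissonian, however its residues are distributed. Let $S_k$ be the number of pairs $1 \<le> i, j \<le> p^k$, diagonal
  included, for which the $i$-th and the $j$-th term agree modulo $p^k$.

  Take $N = m p^k$ and $s = m$. The disc then has radius and measure exactly $p^{-k}$, and two terms
  lie within distance $s/N$ if and only if they agree modulo $p^k$. As $i$ and $j$
  run through $m$ full periods, there are $m^2 S_k$ such pairs, of which
  $m p^k$ are diagonal. Hence
  \[ F_{N,p}(m) = \frac{p^k (m^2 S_k - m p^k)}{m^2 p^{2k}} = \frac{S_k}{p^k} - \frac{1}{m}, \]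
  which is \<open>padic_pair_corr_periodic\<close>. The values for $m = 2$ and $m = 1$ differ by $1/2$ for every
  $k$, so they cannot both tend to 1.
\<close>

lemma Zp_nat_pow_residue_cong:
  assumes "x k = y k"
  shows "(x [^]\<^bsub>Zp p\<^esub> (i::nat)) k = (y [^]\<^bsub>Zp p\<^esub> i) k"
  by (induction i) (simp_all add: Zp_simps assms)

lemma Zp_finsum_residue_cong:
  assumes "p > 0" "finite A"
    and "\<And>i. i \<in> A \<Longrightarrow> g i \<in> carrier (Zp p)" "\<And>i. i \<in> A \<Longrightarrow> h i \<in> carrier (Zp p)"
    and "\<And>i. i \<in> A \<Longrightarrow> g i k = h i k"
  shows "(\<Oplus>\<^bsub>Zp p\<^esub>i\<in>A. g i) k = (\<Oplus>\<^bsub>Zp p\<^esub>i\<in>A. h i) k"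
proof -
  interpret cring "Zp p" by (rule cring_Zp[OF assms(1)])
  show ?thesis
    using assms(2-)
  proof (induction A rule: finite_induct)
    case (insert a A)
    then have "(\<Oplus>\<^bsub>Zp p\<^esub>i\<in>insert a A. g i) = g a \<oplus>\<^bsub>Zp p\<^esub> (\<Oplus>\<^bsub>Zp p\<^esub>i\<in>A. g i)"
      "(\<Oplus>\<^bsub>Zp p\<^esub>i\<in>insert a A. h i) = h a \<oplus>\<^bsub>Zp p\<^esub> (\<Oplus>\<^bsub>Zp p\<^esub>i\<in>A. h i)"
      by (auto intro!: finsum_insert)
    then show ?case using insert by (simp add: Zp_simps(5))
  qed simp
qed

lemma Zp_add_pow_one_residue:
  assumes "p > 0"
  shows "([n] \<cdot>\<^bsub>Zp p\<^esub> \<one>\<^bsub>Zp p\<^esub>) k = int n mod int p ^ k"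
proof -
  interpret cring "Zp p" by (rule cring_Zp[OF assms])
  show ?thesis
  proof (induction n)
    case 0
    then show ?case by (simp add: Zp_simps(4))
  next
    case (Suc n)
    have "[Suc n] \<cdot>\<^bsub>Zp p\<^esub> \<one>\<^bsub>Zp p\<^esub> = [n] \<cdot>\<^bsub>Zp p\<^esub> \<one>\<^bsub>Zp p\<^esub> \<oplus>\<^bsub>Zp p\<^esub> \<one>\<^bsub>Zp p\<^esub>"
      by (rule add.nat_pow_Suc)
    then have "([Suc n] \<cdot>\<^bsub>Zp p\<^esub> \<one>\<^bsub>Zp p\<^esub>) k =
        (([n] \<cdot>\<^bsub>Zp p\<^esub> \<one>\<^bsub>Zp p\<^esub>) k + \<one>\<^bsub>Zp p\<^esub> k) mod int p ^ k"
      by (simp add: Zp_simps(5))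
    also have "\<dots> = int (Suc n) mod int p ^ k"
      by (subst Suc) (simp add: Zp_simps(3) mod_simps add.commute)
    finally show ?case .
  qed
qed

lemma Zp_eval_closed:
  assumes "p > 0" "f \<in> carrier (UP (Zp p))" "x \<in> carrier (Zp p)"
  shows "eval (Zp p) (Zp p) id x f \<in> carrier (Zp p)"
proof -
  interpret UP_cring "Zp p" "UP (Zp p)"
    by (intro UP_cring.intro cring_Zp assms(1))
  have "coeff (UP (Zp p)) f i \<in> carrier (Zp p)" for i
    using assms(2) by (rule coeff_closed)
  then show ?thesis
    unfolding eval_def restrict_apply'[OF assms(2)]
    using assms(3) by (intro R.finsum_closed) auto
qed

text \<open>
  Reduction modulo $p^k$ is a ring homomorphism, so the residue of a polynomial value depends only
  on the residue of the argument.
\<close>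

lemma Zp_eval_cong:
  assumes "p > 0" and f: "f \<in> carrier (UP (Zp p))"
    and xy: "x \<in> carrier (Zp p)" "y \<in> carrier (Zp p)" "x k = y k"
  shows "eval (Zp p) (Zp p) id x f k = eval (Zp p) (Zp p) id y f k"
proof -
  interpret UP_cring "Zp p" "UP (Zp p)"
    by (intro UP_cring.intro cring_Zp assms(1))
  have coeff: "coeff (UP (Zp p)) f i \<in> carrier (Zp p)" for i
    using f by (rule coeff_closed)
  show ?thesis
    unfolding eval_def restrict_apply'[OF f]
  proof (rule Zp_finsum_residue_cong[OF assms(1)])
    fix i
    show "(id (coeff (UP (Zp p)) f i) \<otimes>\<^bsub>Zp p\<^esub> x [^]\<^bsub>Zp p\<^esub> i) k =
        (id (coeff (UP (Zp p)) f i) \<otimes>\<^bsub>Zp p\<^esub> y [^]\<^bsub>Zp p\<^esub> i) k"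
      by (simp add: Zp_simps(2) Zp_nat_pow_residue_cong[of x k y, OF xy(3)])
  qed (use coeff xy in auto)
qed

lemma sum_periodic:
  fixes g :: "nat \<Rightarrow> nat"
  assumes "\<And>n. g (n + K) = g n"
  shows "sum g {1..m * K} = m * sum g {1..K}"
proof (induction m)
  case (Suc m)
  have shift: "g (n + m * K) = g n" for n
    by (induction m) (use assms in \<open>simp_all add: add.assoc[symmetric] add.commute[of K]\<close>)
  have "sum g {1..Suc m * K} = sum g {1..m * K} + sum g {m * K + 1..m * K + K}"
    using sum.ub_add_nat[of 1 "m * K" g K] by (simp add: add.commute)
  also have "sum g {m * K + 1..m * K + K} = (\<Sum>n = 1..K. g (n + m * K))"
    using sum.shift_bounds_cl_nat_ivl[of g 1 "m * K" K] by (simp add: add.commute)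
  finally show ?case using Suc by (simp add: shift)
qed simp

lemma card_pairs_periodic:
  fixes r :: "nat \<Rightarrow> 'a"
  assumes "\<And>n. r (n + K) = r n"
  shows "card {(i, j). i \<in> {1..m * K} \<and> j \<in> {1..m * K} \<and> r i = r j} =
         m\<^sup>2 * card {(i, j). i \<in> {1..K} \<and> j \<in> {1..K} \<and> r i = r j}"
proof -
  have count: "card {(i, j). i \<in> {1..N} \<and> j \<in> {1..N} \<and> r i = r j} =
      (\<Sum>i = 1..N. \<Sum>j = 1..N. of_bool (r i = r j))" for N
  proof -
    have "{(i, j). i \<in> {1..N} \<and> j \<in> {1..N} \<and> r i = r j} =
        (SIGMA i:{1..N}. {j\<in>{1..N}. r i = r j})" by auto
    then show ?thesis by (simp add: Int_def)
  qed
  have inner: "(\<Sum>j = 1..m * K. of_bool (r i = r j)) = m * (\<Sum>j = 1..K. of_bool (r i = r j))"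
    for i
    by (rule sum_periodic) (simp add: assms)
  have outer: "(\<Sum>i = 1..m * K. \<Sum>j = 1..K. of_bool (r i = r j)) =
      m * (\<Sum>i = 1..K. \<Sum>j = 1..K. of_bool (r i = r j))"
    by (rule sum_periodic) (simp add: assms)
  show ?thesis
    unfolding count inner sum_distrib_left[symmetric] outer by (simp add: power2_eq_square)
qed

text \<open>
  The quotient $S_k / p^k$ is the same for every \<^term>\<open>m\<close>, because $m$ full
  periods multiply the number of agreeing pairs by $m^2$; the diagonal, however, grows only like
  \<^term>\<open>m\<close>, and so takes away the share $1/m$.
\<close>

lemma padic_pair_corr_periodic:
  assumes p: "p > 1" and x: "\<And>n. x n \<in> carrier (Zp p)"
    and per: "\<And>n. x (n + p ^ k) k = x n k" and m: "m > 0"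
  shows "padic_pair_corr p x (m * p ^ k) (real m) =
    real (card {(i, j). i \<in> {1..p ^ k} \<and> j \<in> {1..p ^ k} \<and> x i k = x j k}) / real p ^ k
      - 1 / real m"
proof -
  define N where "N = m * p ^ k"
  define S where "S = card {(i, j). i \<in> {1..p ^ k} \<and> j \<in> {1..p ^ k} \<and> x i k = x j k}"
  define A where "A = {(i, j). i \<in> {1..N} \<and> j \<in> {1..N} \<and> x i k = x j k}"
  define B where "B = {(i, j). i \<in> {1..N} \<and> j \<in> {1..N} \<and> i \<noteq> j \<and> x i k = x j k}"
  have radius: "real m / real N = 1 / real p ^ k"
    using m by (simp add: N_def)
  have close: "padic_abs p (x i \<ominus>\<^bsub>Zp p\<^esub> x j) \<le> 1 / real p ^ k \<longleftrightarrow> x i k = x j k" for i j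
    using padic_dist_le_iff[OF p, of "x i" "x j" k] x[of i] x[of j]
    by (simp add: padic_dist_def Zp_simps(1))
  have "A \<subseteq> {1..N} \<times> {1..N}" by (auto simp: A_def)
  then have fin: "finite A" by (rule finite_subset) simp
  have split: "A = B \<union> (\<lambda>i. (i, i)) ` {1..N}" by (auto simp: A_def B_def)
  have "card A = card B + card ((\<lambda>i. (i, i)) ` {1..N})"
    using fin unfolding split by (intro card_Un_disjoint) (auto simp: B_def)
  also have "card ((\<lambda>i. (i, i)) ` {1..N}) = N"
    by (simp add: card_image inj_on_def)
  finally have "card B + N = m\<^sup>2 * S"
    using card_pairs_periodic[of "\<lambda>i. x i k" "p ^ k" m, OF per]
    by (simp add: A_def N_def S_def)
  then have B: "real (card B) = (real m)\<^sup>2 * real S - real N"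
    by (metis add_diff_cancel_right' of_nat_add of_nat_mult of_nat_power)
  have "padic_pair_corr p x N (real m) = 1 / (real N)\<^sup>2 * real p ^ k * real (card B)"
    unfolding padic_pair_corr_def radius measure_padic_disc[OF p] close B_def by simp
  also have "\<dots> = real S / real p ^ k - 1 / real m"
    using p m unfolding B by (simp add: N_def field_simps power2_eq_square)
  finally show ?thesis by (simp add: N_def S_def)
qed

lemma not_padic_poissonian_periodic:
  assumes p: "p > 1" and x: "\<And>n. x n \<in> carrier (Zp p)"
    and per: "\<And>n k. x (n + p ^ k) k = x n k"
  shows "\<not> padic_poissonian p x"
proof
  assume poisson: "padic_poissonian p x"
  have lim: "(\<lambda>k. padic_pair_corr p x (m * p ^ k) (real m)) \<longlonglongrightarrow> 1" if "m > 0" for m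
  proof -
    have "strict_mono (\<lambda>k. m * p ^ k)"
      using p that by (auto simp: strict_mono_def)
    moreover have "(\<lambda>N. padic_pair_corr p x N (real m)) \<longlonglongrightarrow> 1"
      using poisson that by (simp add: padic_poissonian_def)
    ultimately show ?thesis
      using LIMSEQ_subseq_LIMSEQ unfolding comp_def by blast
  qed
  have "(\<lambda>k. padic_pair_corr p x (2 * p ^ k) (real 2) - padic_pair_corr p x (1 * p ^ k) (real 1))
      \<longlonglongrightarrow> 1 - 1"
    by (intro tendsto_diff lim) auto
  moreover have "padic_pair_corr p x (2 * p ^ k) (real 2) - padic_pair_corr p x (1 * p ^ k) (real 1)
      = 1 / 2" for k
  proof -
    have "padic_pair_corr p x (m * p ^ k) (real m) =
        real (card {(i, j). i \<in> {1..p ^ k} \<and> j \<in> {1..p ^ k} \<and> x i k = x j k}) / real p ^ k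
          - 1 / real m" if "m > 0" for m
      by (rule padic_pair_corr_periodic) (use p x per that in auto)
    from this[of 2] this[of 1] show ?thesis by simp
  qed
  ultimately have "(\<lambda>k::nat. 1 / 2 :: real) \<longlonglongrightarrow> 1 - 1" by (simp only:)
  then show False by (simp add: LIMSEQ_const_iff)
qed

theorem theorem1p6:
  fixes p :: nat and f :: "nat \<Rightarrow> nat \<Rightarrow> int"
  assumes "prime p"
    and "f \<in> carrier (UP (Zp p))"
  shows "\<not> padic_poissonian p (\<lambda>n. eval (Zp p) (Zp p) id ([n] \<cdot>\<^bsub>Zp p\<^esub> \<one>\<^bsub>Zp p\<^esub>) f)"
proof -
  have p: "p > 1" using assms(1) by (rule prime_gt_1_nat)
  then have p0: "p > 0" by simp
  interpret cring "Zp p" by (rule cring_Zp[OF p0])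
  have n: "[n] \<cdot>\<^bsub>Zp p\<^esub> \<one>\<^bsub>Zp p\<^esub> \<in> carrier (Zp p)" for n :: nat
    by simp
  show ?thesis
    by (rule not_padic_poissonian_periodic[OF p Zp_eval_closed[OF p0 assms(2) n]
          Zp_eval_cong[OF p0 assms(2) n n]])
       (simp add: Zp_add_pow_one_residue[OF p0])
qed

end
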